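(* Let $\mathscr Q_n$ be a non-singular quadric in $\mathrm{PG}(n,2)$ of projective index $g\geq 1$ with point-graph $\Gamma$. Let $\alpha_s$ be an $s$-dimensional subspace contained in $\mathscr Q_n$ with $0<s<g$, and let $\Gamma_s$ be the graph constructed from $\alpha_s$ as described below. Then $\mathrm{Aut}(\Gamma_s)=(\mathrm{Aut}\,\Gamma)_{\alpha_s}$.
   Context: A non-singular quadric $\mathscr Q_n$ in $\mathrm{PG}(n,2)$ is the point set of a non-degenerate quadric; its projective index $g$ is the largest dimension of a projective subspace contained in $\mathscr Q_n$. The point-graph $\Gamma$ has vertex set the points of $\mathscr Q_n$, two distinct points adjacent iff the line joining them is contained in $\mathscr Q_n$. For an $s$-dimensional subspace $\alpha_s\subseteq\mathscr Q_n$: a point $X$ of $\mathscr Q_n$ has type (i) if $X\in\alpha_s$; type (ii) if $X\notin\alpha_s$ and $\langle\alpha_s,X\rangle\subseteq\mathscr Q_n$; type (iii) otherwise. Let $\mathcal X_s$ be the type (ii) points and $\mathcal Y_s$ the points of type (i) or (iii). The graph $\Gamma_s$ has the same vertex set as $\Gamma$ and the same edges, except that for each vertex $R\in\mathcal Y_s$ having exactly $\frac12|\mathcal X_s|$ neighbours in $\mathcal X_s$ (in $\Gamma$), those edges are deleted and $R$ is joined instead to the other $\frac12|\mathcal X_s|$ vertices of $\mathcal X_s$. Since $\Gamma$ and $\Gamma_s$ have the same vertex set, both automorphism groups are regarded as permutation groups on this set; $(\mathrm{Aut}\,\Gamma)_{\alpha_s}$ denotes the subgroup of $\mathrm{Aut}\,\Gamma$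 fixing (setwise) the set of vertices of type (i), i.e. the points of $\alpha_s$. *)

theory Defs
  imports Main
begin

text \<open>Vectors of GF(2)^(n+1) are represented as functions nat => bool
  (True = 1) vanishing outside {0..n}; addition is pointwise xor.
  Since GF(2) has only one nonzero scalar, the points of PG(n,2) are exactly
  the nonzero vectors.\<close>

type_synonym vec = "nat \<Rightarrow> bool"

definition vzero :: vec where "vzero = (\<lambda>_. False)"

definition vadd :: "vec \<Rightarrow> vec \<Rightarrow> vec" where
  "vadd x y = (\<lambda>i. x i \<noteq> y i)"

definition vecs :: "nat \<Rightarrow> vec set" where
  "vecs n = {x. \<forall>i. n < i \<longrightarrow> \<not> x i}"

definition PG_points :: "nat \<Rightarrow> vec set" where
  "PG_points n = vecs n - {vzero}"

text \<open>A quadratic form on GF(2)^(n+1) with coefficients a i j (i \<le> j \<le> n):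
  Q(x) = sum over i \<le> j \<le> n of a_ij x_i x_j (mod 2). The value True means 1.\<close>

definition qform :: "nat \<Rightarrow> (nat \<Rightarrow> nat \<Rightarrow> bool) \<Rightarrow> vec \<Rightarrow> bool" where
  "qform n a x = odd (card {(i, j). i \<le> j \<and> j \<le> n \<and> a i j \<and> x i \<and> x j})"

definition polar :: "nat \<Rightarrow> (nat \<Rightarrow> nat \<Rightarrow> bool) \<Rightarrow> vec \<Rightarrow> vec \<Rightarrow> bool" where
  "polar n a x y = ((qform n a (vadd x y) \<noteq> qform n a x) \<noteq> qform n a y)"

definition nonsingular :: "nat \<Rightarrow> (nat \<Rightarrow> nat \<Rightarrow> bool) \<Rightarrow> bool" where
  "nonsingular n a \<longleftrightarrow>
     \<not> (\<exists>v \<in> PG_points n. \<not> qform n a v \<and> (\<forall>y \<in> vecs n. \<not> polar n a v y))"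

definition quadric :: "nat \<Rightarrow> (nat \<Rightarrow> nat \<Rightarrow> bool) \<Rightarrow> vec set" where
  "quadric n a = {x \<in> PG_points n. \<not> qform n a x}"

text \<open>Projective subspaces of dimension d: nonempty point sets closed under
  the third point of lines, with 2^(d+1)-1 points.\<close>

definition proj_subspace :: "nat \<Rightarrow> vec set \<Rightarrow> nat \<Rightarrow> bool" where
  "proj_subspace n S d \<longleftrightarrow> S \<subseteq> PG_points n \<and> S \<noteq> {} \<and>
     (\<forall>x\<in>S. \<forall>y\<in>S. x \<noteq> y \<longrightarrow> vadd x y \<in> S) \<and> card S = 2 ^ (d + 1) - 1"

definition proj_index :: "nat \<Rightarrow> (nat \<Rightarrow> nat \<Rightarrow> bool) \<Rightarrow> nat \<Rightarrow> bool" where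
  "proj_index n a g \<longleftrightarrow>
     (\<exists>S. proj_subspace n S g \<and> S \<subseteq> quadric n a) \<and>
     (\<forall>S d. proj_subspace n S d \<and> S \<subseteq> quadric n a \<longrightarrow> d \<le> g)"

text \<open>Point graph: distinct points joined iff the line {x, y, x+y} lies in the quadric.\<close>

definition point_adj :: "nat \<Rightarrow> (nat \<Rightarrow> nat \<Rightarrow> bool) \<Rightarrow> vec \<Rightarrow> vec \<Rightarrow> bool" where
  "point_adj n a x y \<longleftrightarrow> x \<in> quadric n a \<and> y \<in> quadric n a \<and> x \<noteq> y \<and>
     vadd x y \<in> quadric n a"

definition span_pt :: "vec set \<Rightarrow> vec \<Rightarrow> vec set" where
  "span_pt S X = S \<union> {X} \<union> (\<lambda>p. vadd X p) ` S"

definition typeII :: "nat \<Rightarrow> (nat \<Rightarrow> nat \<Rightarrow> bool) \<Rightarrow> vec set \<Rightarrow> vec set" where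
  "typeII n a S = {X \<in> quadric n a. X \<notin> S \<and> span_pt S X \<subseteq> quadric n a}"

definition typeIorIII :: "nat \<Rightarrow> (nat \<Rightarrow> nat \<Rightarrow> bool) \<Rightarrow> vec set \<Rightarrow> vec set" where
  "typeIorIII n a S = quadric n a - typeII n a S"

definition switched :: "nat \<Rightarrow> (nat \<Rightarrow> nat \<Rightarrow> bool) \<Rightarrow> vec set \<Rightarrow> vec \<Rightarrow> bool" where
  "switched n a S R \<longleftrightarrow> R \<in> typeIorIII n a S \<and>
     2 * card {X \<in> typeII n a S. point_adj n a R X} = card (typeII n a S)"

definition gamma_s_adj :: "nat \<Rightarrow> (nat \<Rightarrow> nat \<Rightarrow> bool) \<Rightarrow> vec set \<Rightarrow> vec \<Rightarrow> vec \<Rightarrow> bool" where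
  "gamma_s_adj n a S x y \<longleftrightarrow>
     (if (switched n a S x \<and> y \<in> typeII n a S) \<or> (switched n a S y \<and> x \<in> typeII n a S)
      then x \<in> quadric n a \<and> y \<in> quadric n a \<and> x \<noteq> y \<and> \<not> point_adj n a x y
      else point_adj n a x y)"

text \<open>Automorphism group of a graph (V, E), as permutations of V (fixing
  everything outside V, so that groups are compared as permutation groups on V).\<close>

definition graph_aut :: "'v set \<Rightarrow> ('v \<Rightarrow> 'v \<Rightarrow> bool) \<Rightarrow> ('v \<Rightarrow> 'v) set" where
  "graph_aut V E = {f. bij_betw f V V \<and> (\<forall>x. x \<notin> V \<longrightarrow> f x = x) \<and>
     (\<forall>x\<in>V. \<forall>y\<in>V. E x y \<longleftrightarrow> E (f x) (f y))}"

end

theory Submission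
  imports Defs
begin

text \<open>The switched vertices are exactly the type (iii) points. Call a triangle of \<open>\<Gamma>\<^sub>s\<close> odd if every
  other vertex is adjacent to one or three of its vertices. In \<open>\<Gamma>\<close> the lines of the quadric are odd, and
  switching preserves this only for the lines meeting \<open>\<alpha>\<^sub>s\<close>, since on the others it changes an odd
  number of adjacencies. So the points of \<open>\<alpha>\<^sub>s\<close> are recognised in \<open>\<Gamma>\<^sub>s\<close> as the vertices all of whose
  edges lie in odd triangles: an edge between type (ii) and type (iii) lies in none. An automorphism of
  \<open>\<Gamma>\<^sub>s\<close> thus fixes \<open>\<alpha>\<^sub>s\<close>, hence the three types, and so undoes the switching.\<close>

section \<open>Vector addition over GF(2) and finiteness\<close>

lemma vadd_commute: "vadd x y = vadd y x"
  by (auto simp: vadd_def)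

lemma vadd_self [simp]: "vadd x x = vzero"
  by (simp add: vadd_def vzero_def)

lemma vadd_vzero [simp]: "vadd x vzero = x" "vadd vzero x = x"
  by (simp_all add: vadd_def vzero_def)

lemma vadd_cancel [simp]: "vadd x (vadd x y) = y" "vadd (vadd y x) x = y"
  by (auto simp: vadd_def)

lemma vadd_eq_vzero_iff [simp]: "vadd x y = vzero \<longleftrightarrow> x = y"
  by (metis vadd_cancel(1) vadd_vzero(1) vadd_self)

lemma vadd_left_eq_iff [simp]: "vadd x y = vadd x z \<longleftrightarrow> y = z"
  by (metis vadd_cancel(1))

lemma vadd_right_eq_iff [simp]: "vadd y x = vadd z x \<longleftrightarrow> y = z"
  by (metis vadd_cancel(2))

lemma vadd_eq_right_iff [simp]: "vadd x y = y \<longleftrightarrow> x = vzero"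
  by (metis vadd_right_eq_iff vadd_vzero(2))

lemma vadd_eq_left_iff [simp]: "vadd x y = x \<longleftrightarrow> y = vzero"
  by (metis vadd_left_eq_iff vadd_vzero(1))

lemma vecs_vadd: "x \<in> vecs n \<Longrightarrow> y \<in> vecs n \<Longrightarrow> vadd x y \<in> vecs n"
  by (simp add: vecs_def vadd_def)

lemma finite_vecs: "finite (vecs n)"
proof -
  have "vecs n \<subseteq> (\<lambda>A i. i \<in> A) ` Pow {..n}"
  proof
    fix x assume "x \<in> vecs n"
    then have "{i. x i} \<in> Pow {..n}"
      by (auto simp: vecs_def not_less[symmetric])
    moreover have "x = (\<lambda>i. i \<in> {i. x i})" by simp
    ultimately show "x \<in> (\<lambda>A i. i \<in> A) ` Pow {..n}" by blast
  qed
  then show ?thesis by (rule finite_subset) simp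
qed

lemma finite_quadric: "finite (quadric n a)"
  by (rule finite_subset[OF _ finite_vecs[of n]]) (auto simp: quadric_def PG_points_def)

section \<open>The quadratic form and its polar form\<close>

lemma odd_card_xor:
  assumes "finite {p. M p}"
  shows "odd (card {p. M p \<and> P p \<noteq> R p}) \<longleftrightarrow>
    odd (card {p. M p \<and> P p}) \<noteq> odd (card {p. M p \<and> R p})"
proof -
  \<comment> \<open>The overlap \<open>?PR\<close> is counted in both cardinalities on the right and
    cancels mod 2, so parities of counts behave like sums in GF(2).\<close>
  let ?P = "{p. M p \<and> P p \<and> \<not> R p}" and ?R = "{p. M p \<and> R p \<and> \<not> P p}"
    and ?PR = "{p. M p \<and> P p \<and> R p}"
  have fin: "finite ?P" "finite ?R" "finite ?PR"
    by (rule finite_subset[OF _ assms]; blast)+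
  have "card {p. M p \<and> P p \<noteq> R p} = card (?P \<union> ?R)"
    by (rule arg_cong[of _ _ card]) blast
  also have "\<dots> = card ?P + card ?R"
    using fin by (intro card_Un_disjoint) auto
  finally have "card {p. M p \<and> P p \<noteq> R p} = card ?P + card ?R" .
  moreover have "card {p. M p \<and> P p} = card (?P \<union> ?PR)"
    by (rule arg_cong[of _ _ card]) blast
  moreover have "card (?P \<union> ?PR) = card ?P + card ?PR"
    using fin by (intro card_Un_disjoint) auto
  moreover have "card {p. M p \<and> R p} = card (?R \<union> ?PR)"
    by (rule arg_cong[of _ _ card]) blast
  moreover have "card (?R \<union> ?PR) = card ?R + card ?PR"
    using fin by (intro card_Un_disjoint) auto
  ultimately show ?thesis by auto
qed

lemma finite_index_pairs: "finite {p. fst p \<le> snd p \<and> snd p \<le> n \<and> a (fst p) (snd p)}"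
  for n :: nat
  by (rule finite_subset[of _ "{..n} \<times> {..n}"]) auto

lemma qform_pairs:
  "qform n a x \<longleftrightarrow> odd (card {p. (fst p \<le> snd p \<and> snd p \<le> n \<and> a (fst p) (snd p)) \<and>
     (x (fst p) \<and> x (snd p))})"
  unfolding qform_def
  by (rule arg_cong[of _ _ "\<lambda>A. odd (card A)"]) auto

text \<open>Expanding the products at \<open>vadd x y\<close>, the terms with both factors from
  \<open>x\<close> or both from \<open>y\<close> cancel and only the cross terms remain. Bilinearity
  can be read off from this form.\<close>

lemma polar_pairs:
  "polar n a x y \<longleftrightarrow> odd (card {p. (fst p \<le> snd p \<and> snd p \<le> n \<and> a (fst p) (snd p)) \<and>
     ((x (fst p) \<and> y (snd p)) \<noteq> (y (fst p) \<and> x (snd p)))})"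
  unfolding polar_def qform_pairs odd_card_xor[OF finite_index_pairs[of n a], symmetric]
  by (rule arg_cong[of _ _ "\<lambda>A. odd (card A)"]) (auto simp: vadd_def)

lemma polar_vadd_right: "polar n a x (vadd y z) \<longleftrightarrow> polar n a x y \<noteq> polar n a x z"
  unfolding polar_pairs odd_card_xor[OF finite_index_pairs[of n a], symmetric]
  by (rule arg_cong[of _ _ "\<lambda>A. odd (card A)"]) (auto simp: vadd_def)

lemma polar_commute: "polar n a x y = polar n a y x"
  by (auto simp: polar_def vadd_commute)

lemma polar_vadd_left: "polar n a (vadd x y) z \<longleftrightarrow> polar n a x z \<noteq> polar n a y z"
  by (simp add: polar_commute[of _ _ _ z] polar_vadd_right)

lemma qform_vzero [simp]: "\<not> qform n a vzero"
  by (simp add: qform_def vzero_def)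

lemma polar_self [simp]: "\<not> polar n a x x"
  by (simp add: polar_def)

lemma polar_vzero [simp]: "\<not> polar n a x vzero" "\<not> polar n a vzero x"
  by (simp_all add: polar_def)

lemma qform_vadd: "qform n a (vadd x y) \<longleftrightarrow> (qform n a x \<noteq> qform n a y) \<noteq> polar n a x y"
  by (auto simp: polar_def)

lemma quadric_iff: "x \<in> quadric n a \<longleftrightarrow> x \<in> vecs n \<and> x \<noteq> vzero \<and> \<not> qform n a x"
  by (auto simp: quadric_def PG_points_def)

lemma quadric_vadd_iff:
  "x \<in> quadric n a \<Longrightarrow> y \<in> quadric n a \<Longrightarrow> vadd x y \<in> quadric n a \<longleftrightarrow> x \<noteq> y \<and> \<not> polar n a x y"
  by (auto simp: quadric_iff vecs_vadd qform_vadd)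

lemma point_adj_iff:
  "point_adj n a x y \<longleftrightarrow> x \<in> quadric n a \<and> y \<in> quadric n a \<and> x \<noteq> y \<and> \<not> polar n a x y"
  by (auto simp: point_adj_def quadric_vadd_iff)

text \<open>The source of all witnesses below: no singular point lies in the radical, and this
  applies to \<open>x\<close> and, since the line is singular, also to
  \<open>vadd x y\<close>.\<close>

lemma nonsingular_separates:
  assumes ns: "nonsingular n a" and x: "x \<in> quadric n a" and y: "y \<in> quadric n a"
    and ne: "x \<noteq> y" and perp: "\<not> polar n a x y"
  obtains u where "u \<in> quadric n a" "polar n a u x" "\<not> polar n a u y"
proof -
  have ex: "\<exists>v\<in>vecs n. polar n a v z" if "z \<in> quadric n a" for z
    using ns that polar_commute[of n a z] by (auto simp: nonsingular_def quadric_def)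
  obtain v where v: "v \<in> vecs n" "polar n a v x" using ex[OF x] by blast
  obtain v' where v': "v' \<in> vecs n" "polar n a v' (vadd x y)"
    using ex quadric_vadd_iff[OF x y] ne perp by blast
  \<comment> \<open>One of \<open>v\<close>, \<open>v'\<close>, \<open>vadd v v'\<close> has the
    values 1 at \<open>x\<close> and 0 at \<open>y\<close>.\<close>
  obtain t where t: "t \<in> vecs n" "polar n a t x" "\<not> polar n a t y"
    using v v' vecs_vadd[OF v(1) v'(1)] by (metis polar_vadd_left polar_vadd_right)
  \<comment> \<open>If \<open>t\<close> is not singular, adding \<open>x\<close> corrects the form
    by \<open>polar n a t x\<close>, which is 1, and leaves both polar values unchanged.\<close>
  define u where "u = (if qform n a t then vadd t x else t)"
  have "polar n a u x" "\<not> polar n a u y"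
    using t perp by (simp_all add: u_def polar_vadd_left)
  moreover have "u \<in> quadric n a"
    using t x \<open>polar n a u x\<close> by (auto simp: u_def quadric_iff vecs_vadd qform_vadd)
  ultimately show thesis by (rule that[rotated])
qed

section \<open>Perpendicular parts of totally singular subspaces\<close>

lemma card_insert_vzero:
  assumes "proj_subspace n S d"
  shows "finite S" "card (insert vzero S) = 2 ^ (d + 1)"
proof -
  have "finite (PG_points n)" by (simp add: PG_points_def finite_vecs)
  then show fin: "finite S" using assms by (auto simp: proj_subspace_def intro: finite_subset)
  have "vzero \<notin> S" using assms by (auto simp: proj_subspace_def PG_points_def)
  then show "card (insert vzero S) = 2 ^ (d + 1)"
    using fin assms by (simp add: proj_subspace_def)
qed

text \<open>A linear functional on \<open>U\<close> vanishes on all or half of it: translation by a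
  vector where it is 1 maps the complement of the kernel injectively into the kernel.\<close>

lemma card_perp_hyperplane:
  assumes fin: "finite U" and closed: "\<And>x y. x \<in> U \<Longrightarrow> y \<in> U \<Longrightarrow> vadd x y \<in> U"
  shows "card U \<le> 2 * card {u \<in> U. \<not> polar n a u w}"
proof (cases "\<exists>v\<in>U. polar n a v w")
  case True
  then obtain v where v: "v \<in> U" "polar n a v w" by blast
  have "card {u \<in> U. polar n a u w} \<le> card {u \<in> U. \<not> polar n a u w}"
    by (rule card_inj_on_le[of "vadd v"])
      (use v fin closed in \<open>auto simp: inj_on_def polar_vadd_left\<close>)
  moreover have "card U = card ({u \<in> U. polar n a u w} \<union> {u \<in> U. \<not> polar n a u w})"
    by (rule arg_cong[of _ _ card]) blast
  moreover have "\<dots> = card {u \<in> U. polar n a u w} + card {u \<in> U. \<not> polar n a u w}"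
    using fin by (intro card_Un_disjoint) auto
  ultimately show ?thesis by simp
next
  case False
  then have "{u \<in> U. \<not> polar n a u w} = U" by blast
  then show ?thesis by simp
qed

text \<open>Climb from the intersection of the two subspaces up to \<open>W\<close>: each step doubles the subspace
  of \<open>W\<close> and at most halves the part of \<open>U\<close> perpendicular to it.\<close>

lemma perp_outside_smaller_subspace:
  assumes finU: "finite U" and clU: "\<And>x y. x \<in> U \<Longrightarrow> y \<in> U \<Longrightarrow> vadd x y \<in> U" and "vzero \<in> U"
    and perpU: "\<And>x y. x \<in> U \<Longrightarrow> y \<in> U \<Longrightarrow> \<not> polar n a x y"
    and finW: "finite W" and clW: "\<And>x y. x \<in> W \<Longrightarrow> y \<in> W \<Longrightarrow> vadd x y \<in> W" and "vzero \<in> W"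
    and less: "card W < card U"
  obtains u where "u \<in> U" "u \<notin> W" "\<forall>w\<in>W. \<not> polar n a u w"
proof -
  let ?perp = "\<lambda>T. {u \<in> U. \<forall>w\<in>T. \<not> polar n a u w}"
  \<comment> \<open>The product inequality is the exponential form of a dimension bound: perp of
    \<open>T\<close> in \<open>U\<close> plus \<open>T\<close> is at least \<open>U\<close> plus
    \<open>U \<inter> W\<close>. It is an equality at \<open>T = U \<inter> W\<close>.\<close>
  define F where "F = {T. U \<inter> W \<subseteq> T \<and> T \<subseteq> W \<and> (\<forall>x\<in>T. \<forall>y\<in>T. vadd x y \<in> T) \<and>
    card U * card (U \<inter> W) \<le> card (?perp T) * card T}"
  have "F \<subseteq> Pow W" by (auto simp: F_def)
  then have "finite F" by (rule finite_subset) (simp add: finW)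
  moreover have "?perp (U \<inter> W) = U" using perpU by blast
  then have "U \<inter> W \<in> F" using clU clW by (auto simp: F_def)
  ultimately obtain T where T: "T \<in> F" and maxT: "\<And>T'. T' \<in> F \<Longrightarrow> T \<subseteq> T' \<Longrightarrow> T = T'"
    by (metis empty_iff finite_has_maximal)
  have sub: "U \<inter> W \<subseteq> T" "T \<subseteq> W" and clT: "\<And>x y. x \<in> T \<Longrightarrow> y \<in> T \<Longrightarrow> vadd x y \<in> T"
    and cardT: "card U * card (U \<inter> W) \<le> card (?perp T) * card T"
    using T by (auto simp: F_def)
  have finT: "finite T" using sub finW finite_subset by blast
  have "T = W"
  proof (rule ccontr)
    assume "T \<noteq> W"
    then obtain w where w: "w \<in> W" "w \<notin> T" using sub by blast
    let ?T = "T \<union> vadd w ` T"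
    have "T \<inter> vadd w ` T = {}"
    proof -
      have False if "t \<in> T" "vadd w t \<in> T" for t
        using clT[OF that(2) that(1)] w by simp
      then show ?thesis by blast
    qed
    then have card2: "card ?T = 2 * card T"
      using finT by (simp add: card_Un_disjoint card_image inj_on_def)
    have zT: "vzero \<in> T" using sub \<open>vzero \<in> U\<close> \<open>vzero \<in> W\<close> by blast
    then have wT: "w \<in> vadd w ` T" by (metis image_eqI vadd_vzero(1))
    have "?perp ?T = {u \<in> ?perp T. \<not> polar n a u w}"
      using wT by (auto simp: polar_vadd_right)
    moreover have "card (?perp T) \<le> 2 * card {u \<in> ?perp T. \<not> polar n a u w}"
      by (rule card_perp_hyperplane) (use finU clU in \<open>auto simp: polar_vadd_left\<close>)
    ultimately have "card (?perp T) * card T \<le> card (?perp ?T) * card ?T"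
      by (simp add: card2)
    moreover have "vadd x y \<in> ?T" if "x \<in> ?T" "y \<in> ?T" for x y
    proof -
      have "vadd (vadd w p) q = vadd w (vadd p q)" "vadd p (vadd w q) = vadd w (vadd p q)"
        "vadd (vadd w p) (vadd w q) = vadd p q" for p q
        by (auto simp: vadd_def)
      then show ?thesis using that clT by auto
    qed
    moreover have "?T \<subseteq> W" using sub w clW by auto
    ultimately have "?T \<in> F" using sub cardT by (auto simp: F_def)
    then have "T = ?T" using maxT by blast
    then show False using w wT by blast
  qed
  then have "card U * card (U \<inter> W) \<le> card (?perp W) * card W" using cardT by simp
  \<comment> \<open>As \<open>W\<close> is smaller than \<open>U\<close>, its perp in
    \<open>U\<close> must be larger than \<open>U \<inter> W\<close>, so some perpendicular vector
    of \<open>U\<close> lies outside \<open>W\<close>.\<close>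
  moreover have "card W * card (U \<inter> W) < card U * card (U \<inter> W)"
  proof (rule mult_strict_right_mono[OF less])
    show "0 < card (U \<inter> W)"
      unfolding card_gt_0_iff using finU \<open>vzero \<in> U\<close> \<open>vzero \<in> W\<close> by blast
  qed
  ultimately have "card W * card (U \<inter> W) < card (?perp W) * card W"
    by (rule less_le_trans[rotated])
  then have "card (U \<inter> W) < card (?perp W)"
    unfolding mult.commute[of _ "card W"] by (rule mult_less_cancel1[THEN iffD1, THEN conjunct2])
  then have "\<not> ?perp W \<subseteq> U \<inter> W"
    using finU card_mono[of "U \<inter> W" "?perp W"] by auto
  then show thesis using that by blast
qed

section \<open>The three types of points and the switched vertices\<close>

locale singular_subspace =
  fixes n s :: nat and a :: "nat \<Rightarrow> nat \<Rightarrow> bool" and alpha :: "vec set"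
  assumes nonsing: "nonsingular n a"
    and subspace: "proj_subspace n alpha s" and alpha_sub: "alpha \<subseteq> quadric n a"
    and s_pos: "0 < s"
begin

abbreviation "V \<equiv> quadric n a"
abbreviation "B \<equiv> polar n a"
abbreviation "II \<equiv> typeII n a alpha"
abbreviation "E \<equiv> gamma_s_adj n a alpha"

text \<open>Type (iii) in terms of the polar form; points of \<open>alpha\<close> are excluded
  automatically because \<open>alpha\<close> is totally singular.\<close>

definition III :: "vec set" where "III = {x \<in> V. \<exists>w\<in>alpha. B x w}"

lemma alpha_vadd: "x \<in> alpha \<Longrightarrow> y \<in> alpha \<Longrightarrow> x \<noteq> y \<Longrightarrow> vadd x y \<in> alpha"
  using subspace by (auto simp: proj_subspace_def)

lemma alpha_perp:
  assumes "x \<in> alpha" "y \<in> alpha"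
  shows "\<not> B x y"
proof (cases "x = y")
  case False
  then have "vadd x y \<in> V" using alpha_vadd[OF assms] alpha_sub by blast
  then show ?thesis using quadric_vadd_iff[of x n a y] assms alpha_sub by blast
qed simp

lemma typeII_iff: "x \<in> II \<longleftrightarrow> x \<in> V \<and> x \<notin> alpha \<and> (\<forall>w\<in>alpha. \<not> B x w)"
proof -
  have "vadd x w \<in> V \<longleftrightarrow> \<not> B x w" if "x \<in> V" "x \<notin> alpha" "w \<in> alpha" for w
    using quadric_vadd_iff[of x n a w] that alpha_sub by blast
  then show ?thesis using alpha_sub by (auto simp: typeII_def span_pt_def)
qed

lemma types: "V = alpha \<union> II \<union> III" "alpha \<inter> II = {}" "alpha \<inter> III = {}" "II \<inter> III = {}"
  using alpha_sub alpha_perp by (auto simp: typeII_iff III_def)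

text \<open>Since \<open>alpha\<close> is perpendicular to itself, translation by its points does
  not change the polar values against \<open>alpha\<close>.\<close>

lemma typeII_vadd:
  assumes "w \<in> alpha" "x \<in> II"
  shows "vadd x w \<in> II"
proof -
  have "vadd x w \<in> V" using assms alpha_sub by (auto simp: typeII_iff quadric_vadd_iff)
  moreover have "vadd x w \<notin> alpha"
    using assms alpha_vadd[of "vadd x w" w] by (cases "vadd x w = w") (auto simp: typeII_iff quadric_iff)
  ultimately show ?thesis using assms alpha_perp by (auto simp: typeII_iff polar_vadd_left)
qed

lemma III_vadd:
  assumes "w \<in> alpha" "x \<in> III" "\<not> B x w"
  shows "vadd x w \<in> III"
proof -
  have "x \<noteq> w" using assms types by blast
  then have "vadd x w \<in> V" using assms alpha_sub by (auto simp: III_def quadric_vadd_iff)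
  then show ?thesis using assms alpha_perp by (auto simp: III_def polar_vadd_left)
qed

text \<open>Positive dimension enters here: \<alpha> has at least three points.\<close>

lemma alpha_two_points: obtains w w' where "w \<in> alpha" "w' \<in> alpha" "w \<noteq> w'"
proof -
  have "(2::nat) ^ 2 \<le> 2 ^ (s + 1)" by (rule power_increasing) (use s_pos in auto)
  then have "card alpha \<ge> 2" using subspace by (simp add: proj_subspace_def)
  then show thesis using that 
    by (metis card_2_iff' obtain_subset_with_card_n subsetD)
qed

text \<open>If \<open>B R w\<close> with \<open>w\<close> in \<open>alpha\<close>, translation by
  \<open>w\<close> exchanges the neighbours and non-neighbours of \<open>R\<close> in
  \<open>II\<close>, so exactly half are neighbours. A point of \<open>alpha\<close> is adjacent to
  all of \<open>II\<close>, which is half of it only when \<open>II\<close> is empty.\<close>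

lemma switched_iff:
  assumes "II \<noteq> {}"
  shows "switched n a alpha R \<longleftrightarrow> R \<in> III"
proof (cases "R \<in> III")
  case True
  then obtain w where w: "w \<in> alpha" "B R w" by (auto simp: III_def)
  have R: "R \<in> V" "R \<notin> II" using True types by auto
  let ?A = "{x \<in> II. point_adj n a R x}" and ?N = "{x \<in> II. \<not> point_adj n a R x}"
  have adj: "point_adj n a R x \<longleftrightarrow> \<not> B R x" if "x \<in> II" for x
    using that R by (auto simp: point_adj_iff typeII_iff)
  have "bij_betw (\<lambda>x. vadd x w) ?A ?N"
    by (rule bij_betw_byWitness[where f' = "\<lambda>x. vadd x w"])
      (use w in \<open>auto simp: adj typeII_vadd polar_vadd_right\<close>)
  then have "card ?A = card ?N" by (rule bij_betw_same_card)
  moreover have "finite II" by (simp add: typeII_def finite_quadric)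
  then have "card (?A \<union> ?N) = card ?A + card ?N" by (intro card_Un_disjoint) auto
  moreover have "?A \<union> ?N = II" by blast
  ultimately show ?thesis using R True by (simp add: switched_def typeIorIII_def)
next
  case False
  have "\<not> switched n a alpha R"
  proof
    assume sw: "switched n a alpha R"
    then have R: "R \<in> alpha" using False types by (auto simp: switched_def typeIorIII_def)
    then have "point_adj n a R x" if "x \<in> II" for x
      using that alpha_sub by (auto simp: point_adj_iff typeII_iff polar_commute)
    then have "{x \<in> II. point_adj n a R x} = II" by blast
    then have "card II = 0" using sw by (simp add: switched_def)
    then show False using assms by (simp add: typeII_def finite_quadric)
  qed
  then show ?thesis using False by simp
qed

end

section \<open>Edges and odd triangles of the switched graph\<close>

locale switched_subspace = singular_subspace +
  assumes typeII_nonempty: "II \<noteq> {}"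
begin

lemma E_iff:
  assumes "x \<in> V" "y \<in> V"
  shows "E x y \<longleftrightarrow> x \<noteq> y \<and> (B x y \<longleftrightarrow> x \<in> III \<and> y \<in> II \<or> y \<in> III \<and> x \<in> II)"
  using assms types by (auto simp: gamma_s_adj_def switched_iff[OF typeII_nonempty] point_adj_iff)

text \<open>Supplies the edge that will lie in no odd triangle. For \<open>x\<close> in
  \<open>II\<close>, a point separating \<open>x\<close> from \<open>vadd x w\<close> is not
  perpendicular to \<open>w\<close>, hence of type (iii). For \<open>x\<close> in \<open>III\<close>
  with \<open>B x w\<close>, one of \<open>y\<close>, \<open>vadd y w\<close> is not perpendicular
  to \<open>x\<close>.\<close>

lemma E_diff_type:
  assumes "x \<in> V" "x \<notin> alpha"
  obtains y where "y \<in> V" "E x y" "x \<in> II \<and> y \<in> III \<or> x \<in> III \<and> y \<in> II"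
proof -
  consider "x \<in> II" | "x \<in> III" using assms types by blast
  then show thesis
  proof cases
    case 1
    obtain w where w: "w \<in> alpha" using subspace by (auto simp: proj_subspace_def)
    have "vadd x w \<in> V" using typeII_vadd[OF w 1] types by blast
    moreover have "\<not> B x w" using 1 w by (auto simp: typeII_iff)
    moreover have "x \<noteq> vadd x w"
      using w alpha_sub by (metis quadric_iff subsetD vadd_cancel(1) vadd_self)
    ultimately obtain u where u: "u \<in> V" "B u x" "\<not> B u (vadd x w)"
      using nonsingular_separates[OF nonsing assms(1), of "vadd x w"] by (auto simp: polar_vadd_right)
    then have "u \<in> III" using w by (auto simp: III_def polar_vadd_right)
    then show thesis
      using that[of u] u 1 assms types by (auto simp: E_iff polar_commute)
  next
    case 2
    then obtain w where w: "w \<in> alpha" "B x w" by (auto simp: III_def)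
    obtain y where y: "y \<in> II" using typeII_nonempty by blast
    obtain z where "z \<in> II" "B x z"
    proof (cases "B x y")
      case False
      then show thesis using that[of "vadd y w"] typeII_vadd[OF w(1) y] w by (simp add: polar_vadd_right)
    qed (use y that in blast)
    then show thesis
      using that[of z] 2 assms types by (auto simp: E_iff)
  qed
qed

text \<open>If every vertex off the triple is adjacent to an odd number of its points, then
  \<open>u \<mapsto> B u (x + y + z)\<close> is, on the quadric, a combination of the indicators of the two switched classes.
  Additivity of \<open>B\<close> along two singular lines, one avoiding the perp of \<open>alpha\<close> and one of type
  (II, III, III), forces both coefficients to vanish.\<close>

lemma odd_triple_types:
  assumes V: "x \<in> V" "y \<in> V" "z \<in> V" and clique: "E x y" "E x z" "E y z"
    and odd: "\<And>u. u \<in> V \<Longrightarrow> u \<notin> {x, y, z} \<Longrightarrow> E u x = (E u y = E u z)"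
  shows "\<not> (x \<in> II \<and> y \<in> III)" "\<not> (x \<in> III \<and> y \<in> II)"
proof -
  define d where "d = vadd x (vadd y z)"
  define p where "p \<longleftrightarrow> ((x \<in> II) \<noteq> (y \<in> II)) \<noteq> (z \<in> II)"
  define q where "q \<longleftrightarrow> ((x \<in> III) \<noteq> (y \<in> III)) \<noteq> (z \<in> III)"
  have Bd: "B u d \<longleftrightarrow> (p \<and> u \<in> III) \<noteq> (q \<and> u \<in> II)" if u: "u \<in> V" for u
  proof -
    \<comment> \<open>Counting a vertex as adjacent to itself makes the parity condition hold at
      \<open>x\<close>, \<open>y\<close>, \<open>z\<close> too, since they form a clique.\<close>
    have f: "B u v \<longleftrightarrow> (u \<noteq> v \<longrightarrow> E u v) = (u \<in> III \<and> v \<in> II \<or> v \<in> III \<and> u \<in> II)" if "v \<in> V" for v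
      using E_iff[OF u that] types by (cases "u = v") auto
    have sym: "E v v' \<Longrightarrow> v \<in> V \<Longrightarrow> v' \<in> V \<Longrightarrow> E v' v" for v v'
      by (auto simp: E_iff polar_commute)
    have "(u \<noteq> x \<longrightarrow> E u x) = ((u \<noteq> y \<longrightarrow> E u y) = (u \<noteq> z \<longrightarrow> E u z))"
    proof (cases "u \<in> {x, y, z}")
      case True
      then show ?thesis using clique sym V by auto
    next
      case False
      then show ?thesis using odd[OF u] by auto
    qed
    moreover have "u \<notin> II \<or> u \<notin> III" using types by blast
    ultimately show ?thesis
      unfolding d_def polar_vadd_right f[OF V(1)] f[OF V(2)] f[OF V(3)] p_def q_def by argo
  qed
  obtain w w' where w: "w \<in> alpha" "w' \<in> alpha" "w \<noteq> w'" by (rule alpha_two_points)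
  have wV: "w \<in> V" "w' \<in> V" using w alpha_sub by auto
  have "\<not> p"
  proof
    assume p
    obtain u where u: "u \<in> V" "B u w" "\<not> B u w'"
      using nonsingular_separates[OF nonsing wV w(3) alpha_perp[OF w(1,2)]] .
    obtain v0 where v0: "v0 \<in> V" "B v0 w'" "\<not> B v0 w"
      using nonsingular_separates[OF nonsing wV(2,1)] w alpha_perp by blast
    \<comment> \<open>Adding \<open>w\<close> flips the value at \<open>u\<close>, because
      \<open>B u w\<close>, and keeps those at \<open>w\<close> and \<open>w'\<close>. Thus
      \<open>u\<close>, \<open>v\<close> and their sum are all of type (iii), and \<open>p\<close>
      would make \<open>d\<close> non-perpendicular to three collinear points.\<close>
    define v where "v = (if B u v0 then vadd v0 w else v0)"
    have v: "v \<in> V" "B v w'" "\<not> B v w" "\<not> B u v"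
      using v0 u wV w alpha_perp by (auto simp: v_def quadric_vadd_iff polar_vadd_left polar_vadd_right)
    then have "vadd u v \<in> V" using u by (auto simp: quadric_vadd_iff)
    moreover have "B (vadd u v) w" using u v by (simp add: polar_vadd_left)
    ultimately have III: "u \<in> III" "v \<in> III" "vadd u v \<in> III"
      using u v w by (auto simp: III_def)
    then have "B u d" "B v d" "B (vadd u v) d"
      using \<open>p\<close> Bd types by blast+
    then show False by (simp add: polar_vadd_left)
  qed
  moreover have "\<not> q"
  proof
    assume q
    obtain t where t: "t \<in> II" using typeII_nonempty by blast
    then have tV: "t \<in> V" "\<not> B w t" "w \<noteq> t" using w by (auto simp: typeII_iff polar_commute)
    obtain u where u: "u \<in> V" "B u w" "\<not> B u t"
      using nonsingular_separates[OF nonsing wV(1) tV(1,3,2)] .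
    have "B (vadd u t) w" using u t w by (auto simp: typeII_iff polar_vadd_left)
    moreover have "vadd u t \<in> V" using u t tV w by (auto simp: quadric_vadd_iff polar_commute)
    ultimately have "u \<in> III" "vadd u t \<in> III" using u w by (auto simp: III_def)
    then have "\<not> B u d" "\<not> B (vadd u t) d" "B t d"
      using \<open>q\<close> \<open>\<not> p\<close> Bd t types by blast+
    then show False by (simp add: polar_vadd_left)
  qed
  \<comment> \<open>With one vertex in \<open>II\<close> and one in \<open>III\<close>, both
    parities vanish only if \<open>z\<close> belongs to both classes.\<close>
  ultimately show "\<not> (x \<in> II \<and> y \<in> III)" "\<not> (x \<in> III \<and> y \<in> II)"
    using types unfolding p_def q_def by blast+
qed

text \<open>For \<open>P\<close> in \<open>alpha\<close> the third vertex is
  \<open>vadd x P\<close>: it has the type of \<open>x\<close>, so switching alters the adjacencies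
  of any \<open>u\<close> to both or to neither, and none to \<open>P\<close>. Off
  \<open>alpha\<close>, an edge joining types (ii) and (iii) violates the condition.\<close>

lemma alpha_iff_edges_in_odd_triples:
  assumes P: "P \<in> V"
  shows "P \<in> alpha \<longleftrightarrow> (\<forall>x\<in>V. E P x \<longrightarrow> (\<exists>z\<in>V. E P z \<and> E x z \<and>
    (\<forall>u\<in>V. u \<notin> {P, x, z} \<longrightarrow> E u P = (E u x = E u z))))"
    (is "_ \<longleftrightarrow> ?edges")
proof
  assume alpha: "P \<in> alpha"
  show ?edges
  proof (intro ballI impI)
    fix x assume x: "x \<in> V" "E P x"
    let ?z = "vadd x P"
    have notP: "P \<notin> II" "P \<notin> III" using alpha types by auto
    then have "x \<noteq> P" "\<not> B x P" using x P by (auto simp: E_iff polar_commute)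
    then have z: "?z \<in> V" using x P by (auto simp: quadric_vadd_iff)
    have nz: "?z \<noteq> x" "?z \<noteq> P" using P x by (auto simp: quadric_iff)
    have "?z \<in> alpha" if "x \<in> alpha" using that alpha \<open>x \<noteq> P\<close> by (rule alpha_vadd)
    moreover have "?z \<in> II" if "x \<in> II" using typeII_vadd[OF alpha that] .
    moreover have "?z \<in> III" if "x \<in> III" using III_vadd[OF alpha that \<open>\<not> B x P\<close>] .
    ultimately have same: "?z \<in> II \<longleftrightarrow> x \<in> II" "?z \<in> III \<longleftrightarrow> x \<in> III"
      using types x by blast+
    show "\<exists>z\<in>V. E P z \<and> E x z \<and> (\<forall>u\<in>V. u \<notin> {P, x, z} \<longrightarrow> E u P = (E u x = E u z))"
    proof (intro bexI[of _ ?z] conjI ballI impI)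
      show "E P ?z" "E x ?z"
        using x P z nz nz[symmetric] notP same \<open>\<not> B x P\<close> types
        by (auto simp: E_iff polar_vadd_right polar_commute)
      show "E u P = (E u x = E u ?z)" if "u \<in> V" "u \<notin> {P, x, ?z}" for u
        using that x P z notP same by (auto simp: E_iff polar_vadd_right)
    qed (rule z)
  qed
next
  assume edges: ?edges
  show "P \<in> alpha"
  proof (rule ccontr)
    assume "P \<notin> alpha"
    with P obtain x where x: "x \<in> V" "E P x" "P \<in> II \<and> x \<in> III \<or> P \<in> III \<and> x \<in> II"
      by (rule E_diff_type)
    then obtain z where "z \<in> V" "E P z" "E x z"
      "\<forall>u\<in>V. u \<notin> {P, x, z} \<longrightarrow> E u P = (E u x = E u z)"
      using edges by blast
    then show False using odd_triple_types[of P x z] P x by blast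
  qed
qed

section \<open>Automorphisms and the stabiliser of \<alpha>\<close>

lemma aut_image_alpha:
  assumes f: "f \<in> graph_aut V E"
  shows "f ` alpha = alpha"
proof -
  have bij: "bij_betw f V V" and E: "\<And>x y. x \<in> V \<Longrightarrow> y \<in> V \<Longrightarrow> E (f x) (f y) \<longleftrightarrow> E x y"
    using f by (auto simp: graph_aut_def)
  have im: "f ` V = V" and inj: "inj_on f V" using bij by (auto simp: bij_betw_def)
  have fV: "f x \<in> V" if "x \<in> V" for x using im that by blast
  \<comment> \<open>The criterion for \<open>alpha\<close> mentions only \<open>V\<close> and
    \<open>E\<close>; as \<open>f\<close> is onto \<open>V\<close>, every quantifier in it can be
    re-indexed along \<open>f\<close>.\<close>
  have ball: "(\<forall>x\<in>V. R x) \<longleftrightarrow> (\<forall>x\<in>V. R (f x))" and bex: "(\<exists>x\<in>V. R x) \<longleftrightarrow> (\<exists>x\<in>V. R (f x))" for R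
    using im by (metis imageE image_eqI)+
  have eq: "f x = f y \<longleftrightarrow> x = y" if "x \<in> V" "y \<in> V" for x y
    using inj that by (auto dest: inj_onD)
  have iff: "f P \<in> alpha \<longleftrightarrow> P \<in> alpha" if P: "P \<in> V" for P
  proof -
    let ?odd = "\<lambda>P x z. \<forall>u\<in>V. u \<notin> {P, x, z} \<longrightarrow> E u P = (E u x = E u z)"
    let ?edge = "\<lambda>P x. E P x \<longrightarrow> (\<exists>z\<in>V. E P z \<and> E x z \<and> ?odd P x z)"
    have odd: "?odd (f P) (f x) (f z) \<longleftrightarrow> ?odd P x z" if "x \<in> V" "z \<in> V" for x z
      using P that by (subst ball) (simp add: E eq cong: ball_cong)
    have edge: "?edge (f P) (f x) \<longleftrightarrow> ?edge P x" if x: "x \<in> V" for x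
    proof -
      have "(\<exists>z\<in>V. E (f P) z \<and> E (f x) z \<and> ?odd (f P) (f x) z) \<longleftrightarrow>
          (\<exists>z\<in>V. E (f P) (f z) \<and> E (f x) (f z) \<and> ?odd (f P) (f x) (f z))"
        by (rule bex)
      also have "\<dots> \<longleftrightarrow> (\<exists>z\<in>V. E P z \<and> E x z \<and> ?odd P x z)"
        by (intro bex_cong refl) (simp only: E P x odd)
      finally show ?thesis by (simp only: E P x)
    qed
    have "(\<forall>x\<in>V. ?edge (f P) x) \<longleftrightarrow> (\<forall>x\<in>V. ?edge (f P) (f x))" by (rule ball)
    also have "\<dots> \<longleftrightarrow> (\<forall>x\<in>V. ?edge P x)" by (intro ball_cong refl edge)
    finally show ?thesis
      unfolding alpha_iff_edges_in_odd_triples[OF P] alpha_iff_edges_in_odd_triples[OF fV[OF P]] .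
  qed
  show ?thesis
  proof
    show "f ` alpha \<subseteq> alpha" using iff alpha_sub by blast
    show "alpha \<subseteq> f ` alpha"
    proof
      fix w assume w: "w \<in> alpha"
      then obtain v where "v \<in> V" "w = f v" using alpha_sub im by blast
      then show "w \<in> f ` alpha" using iff w by blast
    qed
  qed
qed

text \<open>Edges at points of \<open>alpha\<close> are never switched, so type (ii) is recognised
  in both graphs by the same rule.\<close>

lemma typeII_iff_E: "x \<in> V \<Longrightarrow> x \<in> II \<longleftrightarrow> x \<notin> alpha \<and> (\<forall>w\<in>alpha. E x w)"
proof -
  assume x: "x \<in> V"
  have "E x w \<longleftrightarrow> x \<noteq> w \<and> \<not> B x w" if w: "w \<in> alpha" for w
  proof -
    have "w \<in> V" "w \<notin> II" "w \<notin> III" using w types by blast+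
    then show ?thesis using x by (simp add: E_iff)
  qed
  then show ?thesis using x by (auto simp: typeII_iff)
qed

lemma typeII_iff_adj: "x \<in> V \<Longrightarrow> x \<in> II \<longleftrightarrow> x \<notin> alpha \<and> (\<forall>w\<in>alpha. point_adj n a x w)"
  using alpha_sub by (auto simp: typeII_iff point_adj_iff)

text \<open>In this xor form switching is visibly its own inverse.\<close>

lemma E_iff_adj:
  assumes "x \<in> V" "y \<in> V"
  shows "E x y \<longleftrightarrow> x \<noteq> y \<and>
    (point_adj n a x y \<noteq> (x \<in> III \<and> y \<in> II \<or> y \<in> III \<and> x \<in> II))"
  using assms by (auto simp: E_iff point_adj_iff)

text \<open>Kept general in \<open>E1\<close> and \<open>E2\<close> to serve both inclusions.
  Preserving \<open>E1\<close> and \<open>alpha\<close> preserves \<open>II\<close>, hence the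
  remaining class \<open>III\<close>, hence the switching term.\<close>

lemma aut_transfer:
  assumes f: "f \<in> graph_aut V E1" and alpha: "f ` alpha = alpha"
    and II: "\<And>x. x \<in> V \<Longrightarrow> x \<in> II \<longleftrightarrow> x \<notin> alpha \<and> (\<forall>w\<in>alpha. E1 x w)"
    and E2: "\<And>x y. x \<in> V \<Longrightarrow> y \<in> V \<Longrightarrow> E2 x y \<longleftrightarrow> x \<noteq> y \<and>
      (E1 x y \<noteq> (x \<in> III \<and> y \<in> II \<or> y \<in> III \<and> x \<in> II))"
  shows "f \<in> graph_aut V E2"
proof -
  have bij: "bij_betw f V V" and E: "\<And>x y. x \<in> V \<Longrightarrow> y \<in> V \<Longrightarrow> E1 (f x) (f y) \<longleftrightarrow> E1 x y"
    and out: "\<And>x. x \<notin> V \<Longrightarrow> f x = x"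
    using f by (auto simp: graph_aut_def)
  have im: "f ` V = V" and inj: "inj_on f V" using bij by (auto simp: bij_betw_def)
  have fV: "f x \<in> V" if "x \<in> V" for x using im that by blast
  have eq: "f x = f y \<longleftrightarrow> x = y" if "x \<in> V" "y \<in> V" for x y
    using inj that by (auto dest: inj_onD)
  have fa: "f x \<in> alpha \<longleftrightarrow> x \<in> alpha" if "x \<in> V" for x
    using alpha inj that alpha_sub inj_on_image_mem_iff by metis
  have fII: "f x \<in> II \<longleftrightarrow> x \<in> II" if x: "x \<in> V" for x
  proof -
    have "(\<forall>w\<in>alpha. E1 (f x) w) \<longleftrightarrow> (\<forall>w\<in>alpha. E1 (f x) (f w))"
      using alpha by (metis imageE image_eqI)
    also have "\<dots> \<longleftrightarrow> (\<forall>w\<in>alpha. E1 x w)" using E x alpha_sub by blast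
    finally show ?thesis by (simp add: II x fV fa)
  qed
  have "f x \<in> III \<longleftrightarrow> x \<in> III" if "x \<in> V" for x
    using fII[OF that] fa[OF that] fV[OF that] that types by blast
  then show ?thesis
    using bij out by (simp add: graph_aut_def E2 E eq fII fV)
qed

lemma aut_eq:
  "graph_aut V E = {f \<in> graph_aut V (point_adj n a). f ` alpha = alpha}"
proof (rule equalityI; rule subsetI)
  fix f assume f: "f \<in> graph_aut V E"
  have alpha: "f ` alpha = alpha" by (rule aut_image_alpha[OF f])
  have "f \<in> graph_aut V (point_adj n a)"
    by (rule aut_transfer[OF f alpha typeII_iff_E])
      (auto simp: E_iff_adj point_adj_def)
  with alpha show "f \<in> {f \<in> graph_aut V (point_adj n a). f ` alpha = alpha}" by blast
next
  fix f assume "f \<in> {f \<in> graph_aut V (point_adj n a). f ` alpha = alpha}"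
  then show "f \<in> graph_aut V E"
    using aut_transfer[of f "point_adj n a" E] typeII_iff_adj E_iff_adj by blast
qed

end

theorem theorem7p1:
  fixes n s g :: nat and a :: "nat \<Rightarrow> nat \<Rightarrow> bool" and alpha :: "vec set"
  assumes "nonsingular n a"
    and "proj_index n a g" and "1 \<le> g"
    and "proj_subspace n alpha s" and "alpha \<subseteq> quadric n a"
    and "0 < s" and "s < g"
  shows "graph_aut (quadric n a) (gamma_s_adj n a alpha) =
         {f \<in> graph_aut (quadric n a) (point_adj n a). f ` alpha = alpha}"
proof -
  interpret singular_subspace n s a alpha
    using assms by unfold_locales
  obtain S where S: "proj_subspace n S g" "S \<subseteq> quadric n a"
    using assms(2) by (auto simp: proj_index_def)
  interpret S: singular_subspace n g a S
    using assms S by unfold_locales auto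
  \<comment> \<open>Adjoining the zero vector gives vector spaces of orders
    \<open>2 ^ (s + 1)\<close> and \<open>2 ^ (g + 1)\<close>, so \<open>s < g\<close> provides a
    vector of \<open>S\<close> outside \<open>alpha\<close> and perpendicular to it: a type (ii)
    point.\<close>
  have less: "card (insert vzero alpha) < card (insert vzero S)"
    using card_insert_vzero(2)[OF S(1)] card_insert_vzero(2)[OF assms(4)] assms(7) by simp
  obtain u where u: "u \<in> insert vzero S" "u \<notin> insert vzero alpha"
      "\<forall>w\<in>insert vzero alpha. \<not> polar n a u w"
  proof (rule perp_outside_smaller_subspace[OF _ _ _ _ _ _ _ less, of n a])
    show "vadd x y \<in> insert vzero S" if "x \<in> insert vzero S" "y \<in> insert vzero S" for x y
      using that S.alpha_vadd by auto
    show "vadd x y \<in> insert vzero alpha" if "x \<in> insert vzero alpha" "y \<in> insert vzero alpha" for x y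
      using that alpha_vadd by auto
    show "\<not> polar n a x y" if "x \<in> insert vzero S" "y \<in> insert vzero S" for x y
      using that S.alpha_perp by auto
  qed (use card_insert_vzero(1)[OF S(1)] card_insert_vzero(1)[OF assms(4)] in auto)
  then have "u \<in> typeII n a alpha" using S by (auto simp: typeII_iff)
  then interpret switched_subspace n s a alpha by unfold_locales blast
  show ?thesis by (rule aut_eq)
qed

end
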